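(* Let $x_0>0$ and let $\phi$ be a function on $[x_0,\infty)$ satisfying Assumption 1 (stated in the context). Let $Y\sim G$ be a random variable with values in $\mathbb{R}_+=[0,\infty)$ having finite moments of all positive integer orders, and let $G$ be absolutely continuous on $\mathbb{R}_{+,x_0}=[x_0,\infty)$ with density $G'(x)=g(x)>0$ on $\mathbb{R}_{+,x_0}$. Assume that $$\limsup_{x\to\infty}\frac{g(x+\phi(x))}{g(x)}<1.$$ Then both $Y$ and $Y^2$ satisfy Carleman's condition $({\rm C_S})$, i.e. $$\sum_{n=1}^{\infty}\left(\mathsf{E}[Y^{n}]\right)^{-1/(2n)}=\infty\quad\text{and}\quad \sum_{n=1}^{\infty}\left(\mathsf{E}[Y^{2n}]\right)^{-1/(2n)}=\infty,$$ and both $Y$ and $Y^2$ are M-det on $\mathbb{R}_+$.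
   Context: $Y\sim G$ means that the random variable $Y$ has distribution (function) $G$. The distribution $G$ is arbitrary on $[0,x_0)$; only its restriction to $[x_0,\infty)$ is assumed absolutely continuous. Carleman's condition $({\rm C_S})$ for a random variable $W$ with values in $\mathbb{R}_+$ and finite moments: $\sum_{n=1}^{\infty}(\mathsf{E}[W^n])^{-1/(2n)}=\infty$. M-determinacy: a random variable with values in $\mathbb{R}_+$ and finite moments of all orders is M-det (moment-determinate) on $\mathbb{R}_+$ if no probability distribution on $\mathbb{R}_+$ other than its own has the same moment sequence (moments of all orders $n\in\mathbb{N}=\{1,2,\ldots\}$). Assumption 1 on $\phi$: $\phi$ is a non-negative differentiable function on $[x_0,\infty)$, with $x_0>0$; the function $y=y(x)=x+\phi(x)$ is strictly increasing in $x$, with inverse function $x(y)$ on $[y_0,\infty)$, where $y_0=y(x_0)$; and the function $\varphi(y)=y-x(y)$ satisfies, for some constants $C_+>0$ and $y_*\ge y_0$: (a) $\varphi'(y)\in[0,1]$ for $y\ge y_*$; (b) $\varphi(y)\le C_+\log y$ for $y\ge y_*$; (c) $y\,\varphi'(y)\le C_+$ for $y\ge y_*$. *)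

theory Defs
  imports "HOL-Probability.Probability"
begin

definition finite_moments :: "'a measure \<Rightarrow> ('a \<Rightarrow> real) \<Rightarrow> bool" where
  "finite_moments M W \<longleftrightarrow> (\<forall>n::nat. n \<ge> 1 \<longrightarrow> integrable M (\<lambda>\<omega>. W \<omega> ^ n))"

text \<open>The series over \<open>n \<ge> 1\<close> is indexed by \<open>Suc n\<close>. The reciprocal is taken in
  \<^typ>\<open>ennreal\<close>, so a vanishing moment contributes \<open>\<infinity>\<close>, in accordance with
  \<open>0\<close> raised to a negative power, whereas \<open>0 powr a = 0\<close> on the reals.\<close>

definition carleman_stieltjes :: "'a measure \<Rightarrow> ('a \<Rightarrow> real) \<Rightarrow> bool" where
  "carleman_stieltjes M W \<longleftrightarrow>
     (\<Sum>n. inverse (ennreal ((\<integral>\<omega>. W \<omega> ^ Suc n \<partial>M) powr (1 / (2 * real (Suc n)))))) = \<infinity>"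

definition moment_determinate_stieltjes :: "'a measure \<Rightarrow> ('a \<Rightarrow> real) \<Rightarrow> bool" where
  "moment_determinate_stieltjes M W \<longleftrightarrow>
     W \<in> borel_measurable M \<and> (\<forall>\<omega>\<in>space M. 0 \<le> W \<omega>) \<and> finite_moments M W \<and>
     (\<forall>N. real_distribution N \<longrightarrow> (AE x in N. 0 \<le> x) \<longrightarrow> finite_moments N (\<lambda>x. x) \<longrightarrow>
        (\<forall>n\<ge>1. (\<integral>x. x ^ n \<partial>N) = (\<integral>\<omega>. W \<omega> ^ n \<partial>M)) \<longrightarrow>
        N = distr M borel W)"

definition shift_defect :: "real \<Rightarrow> (real \<Rightarrow> real) \<Rightarrow> real \<Rightarrow> real" where
  "shift_defect x0 \<phi> y = y - the_inv_into {x0..} (\<lambda>x. x + \<phi> x) y"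

text \<open>Derivatives at the left endpoints \<open>x0\<close> and \<open>x0 + \<phi> x0\<close> are one-sided. The
  function \<open>D\<close> is the derivative of \<open>shift_defect x0 \<phi>\<close> on \<open>{ys..}\<close>, whose existence
  is part of the assumption.\<close>

definition admissible_shift :: "real \<Rightarrow> (real \<Rightarrow> real) \<Rightarrow> bool" where
  "admissible_shift x0 \<phi> \<longleftrightarrow>
     x0 > 0 \<and> (\<forall>x\<ge>x0. 0 \<le> \<phi> x) \<and> \<phi> differentiable_on {x0..} \<and>
     strict_mono_on {x0..} (\<lambda>x. x + \<phi> x) \<and>
     (\<exists>C ys D. C > 0 \<and> ys \<ge> x0 + \<phi> x0 \<and>
        (\<forall>y\<ge>ys. (shift_defect x0 \<phi> has_real_derivative D y) (at y within {x0 + \<phi> x0..}) \<and>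
           D y \<in> {0..1} \<and>
           shift_defect x0 \<phi> y \<le> C * ln y \<and>
           y * D y \<le> C))"

end

theory Submission
  imports Defs
begin

text \<open>The moments of \<open>Y\<close> grow so slowly that even \<open>Y\<^sup>2\<close> satisfies Carleman's condition:
there is a \<open>c\<close> such that the \<open>n\<close>-th moment is at most \<open>(c * n * ln (n + 2)) ^ n\<close> (\<open>moment_growth\<close>).
The reason is a contraction. Far out, the shift to \<open>x + \<phi> x\<close> reduces the density by a factor \<open>q < 1\<close>. The shift itself is
only logarithmic, so it changes \<open>x ^ n\<close> and the volume by factors close to \<open>1\<close> as soon as \<open>x\<close> is a large multiple of
\<open>n * ln n\<close> (\<open>pointwise_contraction\<close>). The part of the moment beyond this threshold is therefore at most a
fixed fraction of the whole moment, so the moment is controlled by the part below the threshold. The roots of order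
\<open>2 * n\<close> of the \<open>n\<close>-th moment of \<open>Y\<^sup>2\<close> are then \<open>O(n * ln n)\<close>, and \<open>1 / (n * ln n)\<close> is not summable.

Determinacy follows from Carleman's condition in general (\<open>carleman_imp_moment_determinate\<close>). Given two laws on
the half-line with the same moments, pass to the laws of the square roots. The difference of their
cosine transforms is flat at \<open>0\<close>, and its derivatives are bounded by a log-convex sequence \<open>M\<close>, the averaged moments.
Flat functions of this kind vanish if the series of \<open>M n / M (n + 1)\<close> diverges. This is the theorem of Denjoy and Carleman,
for which Bang's proof needs only Taylor's formula (\<open>quasi_analytic_vanishing\<close>). Carleman's inequality
translates between this divergence and that of the roots of the moments. Finally, the cosine transform is the characteristic
function of a symmetrized law, and so it determines a law on the half-line.\<close>

section \<open>A quasi-analyticity criterion\<close>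

text \<open>Log-convexity makes the quotients of consecutive terms increase, so each of the \<open>j\<close> quotients between
\<open>M n\<close> and \<open>M (n + j)\<close> is at most the last one.\<close>

lemma log_convex_growth:
  fixes M :: "nat \<Rightarrow> real"
  assumes pos: "\<And>n. 0 < M n" and convex: "\<And>n. (M (Suc n))\<^sup>2 \<le> M n * M (Suc (Suc n))"
    and "n + j \<le> Suc N"
  shows "M (n + j) \<le> M n * (M (Suc N) / M N) ^ j"
proof -
  have step: "M (Suc k) / M k \<le> M (Suc (Suc k)) / M (Suc k)" for k
    using convex[of k] pos[of k] pos[of "Suc k"]
    by (simp add: frac_le_eq divide_simps power2_eq_square mult.commute)
  have ratio: "M (Suc k) / M k \<le> M (Suc N) / M N" if "k \<le> N" for k
    using lift_Suc_mono_le[of "\<lambda>k. M (Suc k) / M k", OF step that] .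
  show ?thesis
    using \<open>n + j \<le> Suc N\<close>
  proof (induction j)
    case (Suc j)
    let ?r = "M (Suc N) / M N"
    have "M (n + Suc j) = M (n + j) * (M (Suc (n + j)) / M (n + j))"
      using pos[of "n + j"] by simp
    also have "\<dots> \<le> M (n + j) * ?r"
      using ratio[of "n + j"] Suc.prems pos[of "n + j"] by (intro mult_left_mono) auto
    also have "\<dots> \<le> (M n * ?r ^ j) * ?r"
      using Suc pos[of "Suc N"] pos[of N] by (intro mult_right_mono) auto
    finally show ?case by (simp add: mult_ac)
  qed simp
qed

lemma exp_partial_sum_le:
  fixes x :: real
  assumes "0 \<le> x"
  shows "(\<Sum>j<k. x ^ j / fact j) \<le> exp x"
proof -
  have "(\<lambda>j. x ^ j / fact j) sums exp x"
    using exp_converges[of x] by (simp add: divide_inverse mult.commute)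
  then show ?thesis
    using sum_le_suminf[of "\<lambda>j. x ^ j / fact j" "{..<k}"] assms
    by (auto simp: sums_iff)
qed

text \<open>The central step of Bang's proof of the Denjoy--Carleman theorem. Measure the size of \<open>F\<close> at \<open>t\<close> by
\<open>sup n. exp (- n) * \<bar>F n t\<bar> / M n\<close>. If it is at most \<open>exp (- (N + 1))\<close> at \<open>t\<close>, then it is at most
\<open>exp (- N)\<close> at distance \<open>h\<close>, provided that \<open>h\<close> does not exceed \<open>M N / (e * M (N + 1))\<close>. Only the orders
\<open>n \<le> N\<close> need an argument, since the a priori bound by \<open>M n\<close> covers the others. For them the Taylor expansion
up to order \<open>N + 1\<close>, with the terms estimated by log-convexity, is a partial sum of the series of
\<open>exp (e * h * M (N + 1) / M N)\<close>, and the argument of this exponential is at most \<open>1\<close>.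

The expansion is assumed as an inequality. In the application \<open>F n\<close> is the \<open>n\<close>-th derivative of an integral
depending on a parameter, and the inequality follows by integrating a pointwise one, with no differentiation under the
integral sign.\<close>

lemma smallness_spreads:
  fixes F :: "nat \<Rightarrow> real \<Rightarrow> real" and M :: "nat \<Rightarrow> real"
  assumes pos: "\<And>n. 0 < M n" and convex: "\<And>n. (M (Suc n))\<^sup>2 \<le> M n * M (Suc (Suc n))"
    and taylor: "\<And>n k t h. 0 \<le> h \<Longrightarrow>
      \<bar>F n (t + h) - (\<Sum>j<k. F (n + j) t / fact j * h ^ j)\<bar> \<le> M (n + k) / fact k * h ^ k"
    and small: "\<And>n. \<bar>F n t\<bar> \<le> exp (real n - real (Suc N)) * M n"
    and h: "0 \<le> h" "h \<le> M N / (exp 1 * M (Suc N))"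
  shows "\<bar>F n (t + h)\<bar> \<le> exp (real n - real N) * M n"
proof (cases "n \<le> N")
  case False
  have "\<bar>F n (t + h)\<bar> \<le> M n"
    using taylor[where n=n and k=0 and t=t, OF h(1)] by simp
  also have "\<dots> \<le> exp (real n - real N) * M n"
    using False pos[of n] by simp
  finally show ?thesis .
next
  case True
  define k where "k = Suc N - n"
  define r where "r = M (Suc N) / M N"
  have k: "n + k = Suc N" using True by (simp add: k_def)
  have r: "0 < r" using pos by (simp add: r_def)
  let ?c = "exp (real n - real (Suc N)) * M n"
  let ?x = "exp 1 * (r * h)"
  have termwise: "exp (real (n + j) - real (Suc N)) * M (n + j) / fact j * h ^ j \<le> ?c * (?x ^ j / fact j)"
    if "j \<le> k" for j
  proof -
    have "M (n + j) \<le> M n * r ^ j"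
      unfolding r_def using that k by (intro log_convex_growth pos convex) auto
    then have "exp (real (n + j) - real (Suc N)) * M (n + j) / fact j * h ^ j
        \<le> exp (real (n + j) - real (Suc N)) * (M n * r ^ j) / fact j * h ^ j"
      using h(1) by (intro mult_right_mono divide_right_mono mult_left_mono) auto
    also have "\<dots> = exp (real n - real (Suc N)) * exp 1 ^ j * (M n * r ^ j) / fact j * h ^ j"
      by (simp add: exp_of_nat_mult[symmetric] exp_add[symmetric] add_ac add_diff_eq diff_add_eq)
    finally show ?thesis by (simp only: power_mult_distrib times_divide_eq_right times_divide_eq_left mult_ac)
  qed
  have "\<bar>F n (t + h)\<bar> \<le> (\<Sum>j<k. \<bar>F (n + j) t / fact j * h ^ j\<bar>) + M (n + k) / fact k * h ^ k"
    using taylor[where n=n and k=k and t=t, OF h(1)]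
      sum_abs[of "\<lambda>j. F (n + j) t / fact j * h ^ j" "{..<k}"] by linarith
  also have "\<dots> \<le> (\<Sum>j<k. ?c * (?x ^ j / fact j)) + ?c * (?x ^ k / fact k)"
  proof (intro add_mono sum_mono)
    fix j assume "j \<in> {..<k}"
    have "\<bar>F (n + j) t / fact j * h ^ j\<bar> = \<bar>F (n + j) t\<bar> / fact j * h ^ j"
      using h(1) by (simp add: abs_mult)
    also have "\<dots> \<le> exp (real (n + j) - real (Suc N)) * M (n + j) / fact j * h ^ j"
      using h(1) small[of "n + j"] by (intro mult_right_mono divide_right_mono) auto
    also have "\<dots> \<le> ?c * (?x ^ j / fact j)"
      using \<open>j \<in> {..<k}\<close> by (intro termwise) auto
    finally show "\<bar>F (n + j) t / fact j * h ^ j\<bar> \<le> ?c * (?x ^ j / fact j)" .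
  next
    show "M (n + k) / fact k * h ^ k \<le> ?c * (?x ^ k / fact k)"
      using termwise[of k] k by simp
  qed
  also have "\<dots> = ?c * (\<Sum>j<Suc k. ?x ^ j / fact j)"
    by (simp add: sum_distrib_left distrib_left)
  also have "\<dots> \<le> ?c * exp ?x"
    using pos[of n] h(1) r by (intro mult_left_mono exp_partial_sum_le) auto
  also have "\<dots> \<le> ?c * exp 1"
  proof -
    have "?x \<le> 1"
      using h(2) pos[of N] pos[of "Suc N"] by (simp add: r_def field_simps)
    then show ?thesis using pos[of n] by (intro mult_left_mono) auto
  qed
  also have "\<dots> = exp (real n - real N) * M n"
    by (simp add: exp_add[symmetric])
  finally show ?thesis .
qed

text \<open>A function that is flat at \<open>0\<close> is infinitely small there. By \<open>smallness_spreads\<close> its size cannot grow from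
\<open>exp (- (N + 1))\<close> to \<open>exp (- N)\<close> within a distance less than \<open>M N / (e * M (N + 1))\<close>. Climbing from \<open>0\<close> up to any
positive level would thus take a distance not less than the sum over a tail of a divergent series.\<close>

theorem quasi_analytic_vanishing:
  fixes F :: "nat \<Rightarrow> real \<Rightarrow> real" and M :: "nat \<Rightarrow> real"
  assumes pos: "\<And>n. 0 < M n" and convex: "\<And>n. (M (Suc n))\<^sup>2 \<le> M n * M (Suc (Suc n))"
    and taylor: "\<And>n k t h. 0 \<le> h \<Longrightarrow>
      \<bar>F n (t + h) - (\<Sum>j<k. F (n + j) t / fact j * h ^ j)\<bar> \<le> M (n + k) / fact k * h ^ k"
    and flat: "\<And>n. F n 0 = 0"
    and diverges: "\<not> summable (\<lambda>n. M n / M (Suc n))"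
    and "0 \<le> t"
  shows "F 0 t = 0"
proof -
  define d where "d N = M N / (exp 1 * M (Suc N))" for N
  have d_pos: "0 < d N" for N using pos by (simp add: d_def)
  have small: "\<bar>F n s\<bar> \<le> exp (real n - real N) * M n"
    if "0 \<le> s" "s \<le> (\<Sum>i<j. d (N + i))" for n s N j
    using that
  proof (induction j arbitrary: s N n)
    case 0
    then show ?case using flat pos[of n] by (simp add: less_imp_le)
  next
    case (Suc j)
    define u where "u = min s (\<Sum>i<j. d (Suc N + i))"
    have "0 \<le> (\<Sum>i<j. d (Suc N + i))"
      using d_pos by (intro sum_nonneg less_imp_le)
    then have u: "0 \<le> u" "u \<le> (\<Sum>i<j. d (Suc N + i))" "u \<le> s"
      using Suc.prems(1) by (auto simp: u_def)
    have "s - u \<le> d N"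
      using Suc.prems(2) d_pos[of N] by (auto simp: u_def sum.lessThan_Suc_shift simp del: sum.lessThan_Suc)
    then have "\<bar>F n (u + (s - u))\<bar> \<le> exp (real n - real N) * M n"
      using Suc.IH[OF u(1,2)] u(3)
      by (intro smallness_spreads[OF pos convex taylor]) (auto simp: d_def)
    then show ?case by simp
  qed
  \<comment> \<open>Divergence allows the descent to start at an arbitrarily high level and still reach level \<open>N\<close> only beyond \<open>t\<close>.\<close>
  have "\<bar>F 0 t\<bar> \<le> exp (- real N) * M 0" for N
  proof -
    have "\<exists>j. t \<le> (\<Sum>i<j. d (N + i))"
    proof (rule ccontr)
      assume "\<nexists>j. t \<le> (\<Sum>i<j. d (N + i))"
      then have "\<And>j. (\<Sum>i<j. d (N + i)) \<le> t"
        by (meson linear)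
      then have "summable (\<lambda>i. d (N + i))"
        using d_pos by (intro summableI_nonneg_bounded[where x=t]) (auto simp: less_imp_le)
      then have "summable d"
        by (subst (asm) add.commute) (simp add: summable_iff_shift)
      then have "summable (\<lambda>n. exp 1 * d n)" by (rule summable_mult)
      then show False using diverges by (simp add: d_def)
    qed
    then obtain j where "t \<le> (\<Sum>i<j. d (N + i))" ..
    then show ?thesis using small[where s=t and j=j and N=N and n=0] \<open>0 \<le> t\<close> by simp
  qed
  moreover have "(\<lambda>N. exp (- real N) * M 0) \<longlonglongrightarrow> 0"
    by real_asymp
  ultimately have "\<bar>F 0 t\<bar> \<le> 0"
    by (intro LIMSEQ_le_const) auto
  then show ?thesis by simp
qed

section \<open>Carleman's inequality\<close>

text \<open>The proof of Polya: the arithmetic-geometric mean inequality is applied to \<open>c k * a k\<close>, where the weights \<open>c k\<close>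
are chosen such that the product of the first \<open>n + 1\<close> of them is \<open>(n + 2) ^ (n + 1)\<close>. The resulting coefficients
\<open>1 / ((n + 1) * (n + 2))\<close> telescope, and \<open>c k / (k + 1) = (1 + 1 / (k + 1)) ^ (k + 1)\<close> is at most \<open>e\<close>.\<close>

lemma carleman_inequality:
  fixes a :: "nat \<Rightarrow> real"
  assumes pos: "\<And>k. 0 < a k"
  shows "(\<Sum>n<N. (\<Prod>k\<le>n. a k) powr (1 / real (Suc n))) \<le> exp 1 * (\<Sum>k<N. a k)"
proof -
  define c where "c k = real (Suc (Suc k)) ^ Suc k / real (Suc k) ^ k" for k
  define S where "S n = (\<Sum>k<n. c k * a k)" for n
  have c_pos: "0 < c k" for k by (simp add: c_def)
  have c_prod: "(\<Prod>k\<le>n. c k) = real (Suc (Suc n)) ^ Suc n" for n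
  proof (induction n)
    case (Suc n)
    then show ?case
      by (simp add: c_def del: power_Suc of_nat_Suc)
  qed (simp add: c_def)
  have c_le: "c k \<le> exp 1 * real (Suc k)" for k
  proof -
    have "1 + 1 / real (Suc k) = real (Suc (Suc k)) / real (Suc k)"
      by (simp add: field_simps)
    then have "c k / real (Suc k) = (1 + 1 / real (Suc k)) ^ Suc k"
      by (simp only: c_def power_divide) (simp add: mult.commute del: of_nat_Suc)
    also have "\<dots> \<le> exp (1 / real (Suc k)) ^ Suc k"
      by (intro power_mono exp_ge_add_one_self) auto
    also have "\<dots> = exp 1" by (simp add: exp_of_nat_mult[symmetric] del: power_Suc of_nat_Suc)
    finally show ?thesis by (simp add: divide_simps)
  qed
  \<comment> \<open>The identity \<open>1 / ((n + 1) * (n + 2)) = 1 / (n + 1) - 1 / (n + 2)\<close> prepares the telescoping.\<close>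
  have amgm: "(\<Prod>k\<le>n. a k) powr (1 / real (Suc n))
      \<le> (1 / real (Suc n) - 1 / real (Suc (Suc n))) * S (Suc n)" for n
  proof -
    define P where "P = (\<Prod>k\<le>n. a k)"
    have P: "0 < P" using pos by (simp add: P_def prod_pos)
    let ?G = "P powr (1 / real (Suc n))"
    have "(\<Prod>k\<le>n. c k * a k) powr (1 / real (Suc n))
        = ?G * (real (Suc (Suc n)) powr real (Suc n)) powr (1 / real (Suc n))"
      unfolding prod.distrib c_prod P_def[symmetric]
      by (subst powr_mult) (use P in \<open>simp_all add: mult.commute powr_realpow[symmetric] del: power_Suc of_nat_Suc\<close>)
    also have "\<dots> = ?G * real (Suc (Suc n))"
      by (simp add: powr_powr del: of_nat_Suc)
    finally have "?G * real (Suc (Suc n)) = (\<Prod>k\<le>n. c k * a k) powr (1 / real (Suc n))" ..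
    also have "\<dots> \<le> (\<Sum>k\<le>n. c k * a k / real (Suc n))"
      using arith_geom_mean[of "{..n}" "\<lambda>k. c k * a k"] c_pos pos by (simp add: less_imp_le)
    also have "\<dots> = S (Suc n) / real (Suc n)"
      by (simp only: S_def sum_divide_distrib lessThan_Suc_atMost)
    finally have "?G \<le> S (Suc n) / real (Suc n) / real (Suc (Suc n))"
      by (simp add: pos_le_divide_eq mult_ac del: of_nat_Suc)
    also have "\<dots> = (1 / real (Suc n) - 1 / real (Suc (Suc n))) * S (Suc n)"
      by (simp add: divide_simps)
    finally show ?thesis by (simp add: P_def)
  qed
  have "(\<Sum>n<N. (\<Prod>k\<le>n. a k) powr (1 / real (Suc n))) + S N / real (Suc N)
      \<le> (\<Sum>k<N. c k * a k / real (Suc k))"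
  proof (induction N)
    case (Suc N)
    have "S (Suc N) = S N + c N * a N" by (simp add: S_def)
    then have "c N * a N / real (Suc N) = S (Suc N) / real (Suc N) - S N / real (Suc N)"
      by (simp add: add_divide_distrib)
    with Suc amgm[of N] show ?case
      by (simp add: left_diff_distrib del: of_nat_Suc)
  qed (simp add: S_def)
  also have "\<dots> \<le> (\<Sum>k<N. exp 1 * a k)"
  proof (intro sum_mono)
    fix k
    show "c k * a k / real (Suc k) \<le> exp 1 * a k"
      using mult_right_mono[OF c_le[of k], of "a k"] pos[of k] by (simp add: divide_simps mult_ac)
  qed
  finally have "(\<Sum>n<N. (\<Prod>k\<le>n. a k) powr (1 / real (Suc n))) + S N / real (Suc N)
      \<le> exp 1 * (\<Sum>k<N. a k)"
    by (simp add: sum_distrib_left)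
  moreover have "0 \<le> S N"
    unfolding S_def using c_pos pos by (intro sum_nonneg mult_nonneg_nonneg less_imp_le)
  then have "0 \<le> S N / real (Suc N)" by simp
  ultimately show ?thesis by linarith
qed

text \<open>Carleman's inequality for \<open>a k = M k / M (k + 1)\<close>, whose products telescope. It turns the quotient form of the
divergence condition, as needed for quasi-analyticity, into the root form of Carleman's condition.\<close>

lemma summable_moment_roots:
  fixes M :: "nat \<Rightarrow> real"
  assumes pos: "\<And>n. 0 < M n" and "M 0 = 1" and "summable (\<lambda>n. M n / M (Suc n))"
  shows "summable (\<lambda>n. (1 / M (Suc n)) powr (1 / real (Suc n)))"
proof (rule summableI_nonneg_bounded)
  fix N
  have M_nz: "M n \<noteq> 0" for n using pos[of n] by simp
  have telescope: "(\<Prod>k\<le>n. M k / M (Suc k)) = 1 / M (Suc n)" for n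
    by (induction n) (simp_all add: \<open>M 0 = 1\<close> M_nz)
  have "(\<Sum>n<N. (1 / M (Suc n)) powr (1 / real (Suc n))) \<le> exp 1 * (\<Sum>k<N. M k / M (Suc k))"
    using carleman_inequality[of "\<lambda>k. M k / M (Suc k)" N] pos by (simp add: telescope)
  also have "\<dots> \<le> exp 1 * (\<Sum>k. M k / M (Suc k))"
    using assms(3) pos by (intro mult_left_mono sum_le_suminf) (auto simp: less_imp_le)
  finally show "(\<Sum>n<N. (1 / M (Suc n)) powr (1 / real (Suc n))) \<le> exp 1 * (\<Sum>k. M k / M (Suc k))" .
qed simp

section \<open>Moments determine the cosine transform\<close>

text \<open>The shift of the phase by \<open>n * (pi / 2)\<close> encodes the \<open>n\<close>-th derivative of the cosine, so that this is Taylor's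
formula in \<open>t\<close> for the \<open>n\<close>-th derivative of \<open>cos (t * y)\<close>.\<close>

lemma cos_taylor_bound:
  fixes y t h :: real
  shows "\<bar>y ^ n * cos ((t + h) * y + real n * (pi / 2))
      - (\<Sum>j<k. y ^ (n + j) * cos (t * y + real (n + j) * (pi / 2)) / fact j * h ^ j)\<bar>
    \<le> \<bar>y\<bar> ^ (n + k) / fact k * \<bar>h\<bar> ^ k"
proof -
  define c where "c m u = cos (t * y + real n * (pi / 2) + u + real m * (pi / 2))" for m :: nat and u :: real
  have deriv: "DERIV (c m) u :> c (Suc m) u" for m u
  proof -
    let ?a = "t * y + real n * (pi / 2) + u + real m * (pi / 2)"
    have "c (Suc m) u = cos (?a + pi / 2)" 
      by (simp only: c_def of_nat_Suc distrib_right mult_1_left add_ac)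
    also have "\<dots> = - sin ?a" by (simp add: cos_add)
    finally have "c (Suc m) u = - sin ?a" .
    moreover have "DERIV (c m) u :> - sin ?a"
      unfolding c_def by (auto intro!: derivative_eq_intros)
    ultimately show ?thesis by simp
  qed
  obtain s where s: "c 0 (h * y) = (\<Sum>j<k. c j 0 / fact j * (h * y) ^ j) + c k s / fact k * (h * y) ^ k"
    using Maclaurin_all_le[of c "c 0" "h * y" k] deriv by blast
  have "y ^ n * cos ((t + h) * y + real n * (pi / 2)) = y ^ n * c 0 (h * y)"
    by (simp add: c_def algebra_simps)
  also have "\<dots> = (\<Sum>j<k. y ^ n * (c j 0 / fact j * (h * y) ^ j)) + y ^ n * (c k s / fact k * (h * y) ^ k)"
    unfolding s by (simp add: sum_distrib_left distrib_left)
  also have "(\<Sum>j<k. y ^ n * (c j 0 / fact j * (h * y) ^ j))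
      = (\<Sum>j<k. y ^ (n + j) * cos (t * y + real (n + j) * (pi / 2)) / fact j * h ^ j)"
  proof (intro sum.cong refl)
    fix j
    have "c j 0 = cos (t * y + real (n + j) * (pi / 2))"
      unfolding c_def by (rule arg_cong[where f=cos]) (simp add: field_simps)
    then show "y ^ n * (c j 0 / fact j * (h * y) ^ j)
        = y ^ (n + j) * cos (t * y + real (n + j) * (pi / 2)) / fact j * h ^ j"
      by (simp only: power_add power_mult_distrib times_divide_eq_right times_divide_eq_left mult_ac)
  qed
  finally have "\<bar>y ^ n * cos ((t + h) * y + real n * (pi / 2))
      - (\<Sum>j<k. y ^ (n + j) * cos (t * y + real (n + j) * (pi / 2)) / fact j * h ^ j)\<bar>
      = \<bar>c k s\<bar> * (\<bar>y\<bar> ^ (n + k) / fact k * \<bar>h\<bar> ^ k)"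
    by (simp add: abs_mult power_abs power_add power_mult_distrib)
  also have "\<dots> \<le> 1 * (\<bar>y\<bar> ^ (n + k) / fact k * \<bar>h\<bar> ^ k)"
    by (intro mult_right_mono) (auto simp: c_def)
  finally show ?thesis by simp
qed

lemma cosine_moment_taylor_bound:
  fixes P :: "real measure"
  assumes "real_distribution P" and nonneg: "AE x in P. 0 \<le> x"
    and int: "\<And>n. integrable P (\<lambda>x. x ^ n)" and h: "0 \<le> h"
  defines "C \<equiv> \<lambda>n t. \<integral>x. x ^ n * cos (t * x + real n * (pi / 2)) \<partial>P"
  shows "\<bar>C n (t + h) - (\<Sum>j<k. C (n + j) t / fact j * h ^ j)\<bar>
    \<le> (\<integral>x. x ^ (n + k) \<partial>P) / fact k * h ^ k"
proof -
  interpret real_distribution P by fact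
  have int': "integrable P (\<lambda>x. x ^ m * cos (s * x + b))" for m s b
    by (rule Bochner_Integration.integrable_bound[OF int[of m]])
       (auto simp: abs_mult mult_left_le)
  let ?R = "\<lambda>x. x ^ n * cos ((t + h) * x + real n * (pi / 2))
      - (\<Sum>j<k. x ^ (n + j) * cos (t * x + real (n + j) * (pi / 2)) / fact j * h ^ j)"
  have "C n (t + h) - (\<Sum>j<k. C (n + j) t / fact j * h ^ j) = (\<integral>x. ?R x \<partial>P)"
    unfolding C_def using int'
    by (subst Bochner_Integration.integral_diff) (auto simp: Bochner_Integration.integral_sum)
  then have "\<bar>C n (t + h) - (\<Sum>j<k. C (n + j) t / fact j * h ^ j)\<bar> \<le> (\<integral>x. \<bar>?R x\<bar> \<partial>P)"
    by (simp only: integral_abs_bound)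
  also have "\<dots> \<le> (\<integral>x. x ^ (n + k) / fact k * h ^ k \<partial>P)"
  proof (rule integral_mono_AE)
    show "AE x in P. \<bar>?R x\<bar> \<le> x ^ (n + k) / fact k * h ^ k"
      using nonneg
    proof (rule eventually_mono)
      fix x :: real assume "0 \<le> x"
      then have "\<bar>x\<bar> = x" "\<bar>h\<bar> = h" using h by simp_all
      from cos_taylor_bound[of x n t h k, unfolded this]
      show "\<bar>?R x\<bar> \<le> x ^ (n + k) / fact k * h ^ k" .
    qed
  next
    show "integrable P (\<lambda>x. \<bar>?R x\<bar>)"
      by (intro integrable_abs Bochner_Integration.integrable_diff Bochner_Integration.integrable_sum
          integrable_mult_left integrable_divide int')
  next
    show "integrable P (\<lambda>x. x ^ (n + k) / fact k * h ^ k)"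
      by (intro integrable_mult_left integrable_divide int)
  qed
  finally show ?thesis by simp
qed

text \<open>The integral of \<open>x ^ n * (c - x)\<^sup>2\<close>. In contrast to log-convexity of the moments, which it implies by choice of \<open>c\<close>,
this form is linear in the measure and hence can be added for two distributions.\<close>

lemma moment_quadratic_form_nonneg:
  fixes P :: "real measure"
  assumes nonneg: "AE x in P. 0 \<le> x" and int: "\<And>n. integrable P (\<lambda>x. x ^ n)"
  shows "0 \<le> (\<integral>x. x ^ n \<partial>P) * c\<^sup>2 - 2 * c * (\<integral>x. x ^ Suc n \<partial>P) + (\<integral>x. x ^ Suc (Suc n) \<partial>P)"
proof -
  have "0 \<le> (\<integral>x. x ^ n * (c - x)\<^sup>2 \<partial>P)"
    using nonneg by (intro integral_nonneg_AE) auto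
  also have "(\<lambda>x. x ^ n * (c - x)\<^sup>2) = (\<lambda>x. x ^ n * c\<^sup>2 - 2 * c * x ^ Suc n + x ^ Suc (Suc n))"
    by (auto simp: power2_eq_square algebra_simps)
  also have "(\<integral>x. x ^ n * c\<^sup>2 - 2 * c * x ^ Suc n + x ^ Suc (Suc n) \<partial>P)
      = (\<integral>x. x ^ n \<partial>P) * c\<^sup>2 - 2 * c * (\<integral>x. x ^ Suc n \<partial>P) + (\<integral>x. x ^ Suc (Suc n) \<partial>P)"
    using int by (simp del: power_Suc)
  finally show ?thesis .
qed

lemma moment_pos:
  fixes P :: "real measure"
  assumes sets[measurable_cong]: "sets P = sets borel"
    and nonneg: "AE x in P. 0 \<le> x" and int: "\<And>n. integrable P (\<lambda>x. x ^ n)"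
    and pos: "0 < (\<integral>x. x ^ m \<partial>P)" "0 < m"
  shows "0 < (\<integral>x. x ^ n \<partial>P)"
proof (rule ccontr)
  have nonneg': "AE x in P. 0 \<le> x ^ n" using nonneg by eventually_elim simp
  assume "\<not> 0 < (\<integral>x. x ^ n \<partial>P)"
  then have "(\<integral>x. x ^ n \<partial>P) = 0"
    using integral_nonneg_AE[OF nonneg'] by simp
  then have "AE x in P. x ^ n = 0"
    using integral_nonneg_eq_0_iff_AE[OF int nonneg'] by simp
  then have "AE x in P. x ^ m = 0"
    by eventually_elim (use \<open>0 < m\<close> in auto)
  then have "(\<integral>x. x ^ m \<partial>P) = (\<integral>x. 0 \<partial>P)"
    by (intro integral_cong_AE) auto
  with pos show False by simp
qed

text \<open>The function \<open>F 0\<close>, half of the difference of the two cosine transforms, has derivatives of order \<open>n\<close> bounded by the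
averaged moments \<open>M n\<close>. All of them vanish at \<open>0\<close>: those of even order because the even moments agree, those of odd
order because the cosine is even. Averaging the moments of \<open>P\<close> and \<open>Q\<close> is harmless for Carleman's condition, since the even
ones are not changed by it.\<close>

lemma cosine_transforms_agree:
  fixes P Q :: "real measure"
  assumes P: "real_distribution P" "AE x in P. 0 \<le> x" "\<And>n. integrable P (\<lambda>x. x ^ n)"
    and Q: "real_distribution Q" "AE x in Q. 0 \<le> x" "\<And>n. integrable Q (\<lambda>x. x ^ n)"
    and same: "\<And>n. (\<integral>x. x ^ (2 * n) \<partial>Q) = (\<integral>x. x ^ (2 * n) \<partial>P)"
    and pos: "0 < (\<integral>x. x\<^sup>2 \<partial>P)"
    and carleman: "\<not> summable (\<lambda>n. (1 / (\<integral>x. x ^ (2 * Suc n) \<partial>P)) powr (1 / real (2 * Suc n)))"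
    and "0 \<le> t"
  shows "(\<integral>x. cos (t * x) \<partial>P) = (\<integral>x. cos (t * x) \<partial>Q)"
proof -
  interpret P: real_distribution P by fact
  interpret Q: real_distribution Q by fact
  define p where "p n = (\<integral>x. x ^ n \<partial>P)" for n
  define q where "q n = (\<integral>x. x ^ n \<partial>Q)" for n
  define M where "M n = (p n + q n) / 2" for n
  define C where "C D n t = (\<integral>x. x ^ n * cos (t * x + real n * (pi / 2)) \<partial>D)"
    for D :: "real measure" and n t
  define F where "F n t = (C P n t - C Q n t) / 2" for n t
  have "0 < (\<integral>x. x\<^sup>2 \<partial>Q)" using same[of 1] pos by simp
  then have p_pos: "0 < p n" and q_pos: "0 < q n" for n
    unfolding p_def q_def by (auto intro!: moment_pos[where m=2] P Q pos)
  then have M_pos: "0 < M n" for n by (simp add: M_def add_pos_pos)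
  have even: "q (2 * n) = p (2 * n)" for n
    using same by (simp add: p_def q_def)
  have M_even: "M (2 * n) = p (2 * n)" for n by (simp add: M_def even)
  have convex: "(M (Suc n))\<^sup>2 \<le> M n * M (Suc (Suc n))" for n
  proof -
    \<comment> \<open>The minimum of the quadratic form, at which its being nonnegative is log-convexity.\<close>
    define c where "c = M (Suc n) / M n"
    have "0 \<le> M n * c\<^sup>2 - 2 * c * M (Suc n) + M (Suc (Suc n))"
      using moment_quadratic_form_nonneg[OF P(2,3), of n c] moment_quadratic_form_nonneg[OF Q(2,3), of n c]
      unfolding M_def p_def q_def by (simp add: algebra_simps add_divide_distrib)
    then have "0 \<le> M n * (M n * c\<^sup>2 - 2 * c * M (Suc n) + M (Suc (Suc n)))"
      using M_pos[of n] by simp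
    also have "\<dots> = (M n * c)\<^sup>2 - 2 * (M n * c) * M (Suc n) + M n * M (Suc (Suc n))"
      by (simp add: algebra_simps power2_eq_square)
    also have "M n * c = M (Suc n)" using M_pos[of n] by (simp add: c_def)
    finally show ?thesis by (simp add: power2_eq_square)
  qed
  have half_diff: "\<bar>(A - B) / 2\<bar> \<le> (a + b) / 2" if "\<bar>A\<bar> \<le> a" "\<bar>B\<bar> \<le> b" for A B a b :: real
    using that abs_triangle_ineq4[of A B] by simp
  have taylor: "\<bar>F n (t + h) - (\<Sum>j<k. F (n + j) t / fact j * h ^ j)\<bar> \<le> M (n + k) / fact k * h ^ k"
    if "0 \<le> h" for n k t h
  proof -
    have "F n (t + h) - (\<Sum>j<k. F (n + j) t / fact j * h ^ j) =
        ((C P n (t + h) - (\<Sum>j<k. C P (n + j) t / fact j * h ^ j))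
        - (C Q n (t + h) - (\<Sum>j<k. C Q (n + j) t / fact j * h ^ j))) / 2"
    proof -
      have "(\<Sum>j<k. F (n + j) t / fact j * h ^ j)
          = (\<Sum>j<k. (C P (n + j) t / fact j * h ^ j - C Q (n + j) t / fact j * h ^ j) / 2)"
        by (intro sum.cong) (simp_all add: F_def field_simps)
      then show ?thesis
        by (simp add: F_def sum_subtractf sum_divide_distrib[symmetric])
    qed
    also have "\<bar>\<dots>\<bar> \<le> (p (n + k) / fact k * h ^ k + q (n + k) / fact k * h ^ k) / 2"
      unfolding C_def p_def q_def
      by (intro half_diff cosine_moment_taylor_bound P Q that)
    also have "\<dots> = M (n + k) / fact k * h ^ k"
      by (simp add: M_def field_simps)
    finally show ?thesis .
  qed
  have flat: "F n 0 = 0" for n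
  proof (cases "even n")
    case True
    then obtain m where "n = 2 * m" by (rule evenE)
    then show ?thesis using even[of m] by (simp add: F_def C_def p_def q_def)
  next
    case False
    then obtain m where "n = 2 * m + 1" by (rule oddE)
    then have "cos (real n * (pi / 2)) = cos (real m * pi + pi / 2)"
      by (simp add: algebra_simps add_divide_distrib)
    also have "\<dots> = 0" by (simp add: cos_add)
    finally show ?thesis by (simp add: F_def C_def)
  qed
  have "\<not> summable (\<lambda>n. M n / M (Suc n))"
  proof
    assume "summable (\<lambda>n. M n / M (Suc n))"
    moreover have "M 0 = 1" by (simp add: M_def p_def q_def P.prob_space[unfolded P.space_eq_univ] Q.prob_space[unfolded Q.space_eq_univ])
    ultimately have "summable (\<lambda>n. (1 / M (Suc n)) powr (1 / real (Suc n)))"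
      using M_pos by (intro summable_moment_roots)
    then have "summable ((\<lambda>n. (1 / M (Suc n)) powr (1 / real (Suc n))) \<circ> (\<lambda>n. 2 * n + 1))"
      by (intro summable_reindex) (auto simp: inj_on_def)
    moreover have "((\<lambda>n. (1 / M (Suc n)) powr (1 / real (Suc n))) \<circ> (\<lambda>n. 2 * n + 1))
        = (\<lambda>n. (1 / p (2 * Suc n)) powr (1 / real (2 * Suc n)))"
      unfolding M_even[symmetric] by (rule ext) (simp add: add_ac)
    ultimately show False using carleman by (simp only: p_def)
  qed
  then have "F 0 t = 0"
    by (intro quasi_analytic_vanishing[OF M_pos convex taylor flat _ \<open>0 \<le> t\<close>])
  then show ?thesis by (simp add: F_def C_def)
qed

section \<open>The cosine transform determines a law on the half-line\<close>

text \<open>The law of \<open>x\<close> with an independent fair random sign, where \<open>x\<close> has law \<open>P\<close>. Its characteristic function is the cosine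
transform of \<open>P\<close>.\<close>

definition symmetrization :: "real measure \<Rightarrow> real measure" where
  "symmetrization P =
     distr (P \<Otimes>\<^sub>M measure_pmf (bernoulli_pmf (1/2))) borel (\<lambda>(x, b). if b then x else - x)"

lemma symmetrization_measurable:
  assumes [measurable_cong]: "sets P = sets borel"
  shows "(\<lambda>(x, b). if b then x else - x :: real)
    \<in> borel_measurable (P \<Otimes>\<^sub>M measure_pmf (bernoulli_pmf (1/2)))"
proof -
  let ?B = "measure_pmf (bernoulli_pmf (1/2))"
  have snd: "snd \<in> measurable (P \<Otimes>\<^sub>M ?B) (count_space UNIV)"
    using measurable_snd[of P ?B] by (simp cong: measurable_cong_sets)
  have fst: "fst \<in> borel_measurable (P \<Otimes>\<^sub>M ?B)"
    using measurable_fst[of P ?B] assms by (simp cong: measurable_cong_sets)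
  have "{z \<in> space (P \<Otimes>\<^sub>M ?B). snd z} \<in> sets (P \<Otimes>\<^sub>M ?B)"
    using measurable_sets[OF snd, of "{True}"] by (simp add: vimage_def Int_def conj_commute)
  then show ?thesis
    unfolding split_beta' using fst by (intro measurable_If borel_measurable_uminus)
qed

lemma real_distribution_symmetrization:
  assumes "real_distribution P"
  shows "real_distribution (symmetrization P)"
proof -
  interpret real_distribution P by fact
  have "prob_space (P \<Otimes>\<^sub>M measure_pmf (bernoulli_pmf (1/2)))"
    by (intro prob_space_pair prob_space_axioms measure_pmf.prob_space_axioms)
  then show ?thesis
    unfolding symmetrization_def
    by (intro prob_space.real_distribution_distr symmetrization_measurable) auto
qed

lemma char_symmetrization:
  assumes "real_distribution P"
  shows "char (symmetrization P) t = complex_of_real (\<integral>x. cos (t * x) \<partial>P)"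
proof -
  interpret real_distribution P by fact
  let ?B = "measure_pmf (bernoulli_pmf (1/2))"
  interpret pair: pair_prob_space P ?B ..
  note [measurable] = symmetrization_measurable[OF events_eq_borel]
  have "char (symmetrization P) t = (CLINT z|P \<Otimes>\<^sub>M ?B. iexp (t * (case z of (x, b) \<Rightarrow> if b then x else - x)))"
    unfolding char_def symmetrization_def by (subst integral_distr) auto
  also have "\<dots> = (CLINT x|P. CLINT b|?B. iexp (t * (if b then x else - x)))"
    by (subst pair.integral_fst'[symmetric])
       (auto intro!: pair.integrable_const_bound[where B=1])
  also have "\<dots> = (CLINT x|P. complex_of_real (cos (t * x)))"
  proof (intro Bochner_Integration.integral_cong refl)
    fix x
    have "(CLINT b|?B. iexp (t * (if b then x else - x)))
        = (exp (\<i> * complex_of_real (t * x)) + exp (- (\<i> * complex_of_real (t * x)))) / 2"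
      by (subst integral_measure_pmf[of UNIV]) (auto simp: UNIV_bool scaleR_conv_of_real)
    also have "\<dots> = complex_of_real (cos (t * x))"
      by (simp only: cos_exp_eq[symmetric] cos_of_real)
    finally show "(CLINT b|?B. iexp (t * (if b then x else - x))) = complex_of_real (cos (t * x))" .
  qed
  finally show ?thesis by simp
qed

lemma distr_abs_symmetrization:
  assumes "real_distribution P" "AE x in P. 0 \<le> x"
  shows "distr (symmetrization P) borel abs = P"
proof -
  interpret real_distribution P by fact
  let ?B = "measure_pmf (bernoulli_pmf (1/2))"
  note [measurable] = symmetrization_measurable[OF events_eq_borel]
  have "distr (symmetrization P) borel abs = distr (P \<Otimes>\<^sub>M ?B) borel (\<lambda>z. \<bar>fst z\<bar>)"
    unfolding symmetrization_def
    by (subst distr_distr) (auto intro!: distr_cong simp: comp_def)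
  also have "\<dots> = distr (distr (P \<Otimes>\<^sub>M ?B) P fst) borel abs"
    by (subst distr_distr) (auto simp: comp_def)
  also have "\<dots> = distr P borel abs"
    by (simp only: measure_pmf.distr_pair_fst)
  also have "\<dots> = distr P P (\<lambda>x. x)"
    using assms(2) by (intro distr_cong_AE) auto
  finally show ?thesis by (simp add: distr_id)
qed

text \<open>Uniqueness for characteristic functions identifies the symmetrizations, and a law on the half-line is recovered from its
symmetrization by taking absolute values.\<close>

lemma cosine_transform_unique:
  assumes P: "real_distribution P" "AE x in P. 0 \<le> x"
    and Q: "real_distribution Q" "AE x in Q. 0 \<le> x"
    and eq: "\<And>t. 0 \<le> t \<Longrightarrow> (\<integral>x. cos (t * x) \<partial>P) = (\<integral>x. cos (t * x) \<partial>Q)"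
  shows "P = Q"
proof -
  have "(\<integral>x. cos (t * x) \<partial>P) = (\<integral>x. cos (t * x) \<partial>Q)" for t
    using eq[of t] eq[of "- t"] by (cases "0 \<le> t") auto
  then have "char (symmetrization P) = char (symmetrization Q)"
    using char_symmetrization[OF P(1)] char_symmetrization[OF Q(1)] by (intro ext) simp
  then have "symmetrization P = symmetrization Q"
    by (intro Levy_uniqueness real_distribution_symmetrization P Q)
  then show ?thesis
    using distr_abs_symmetrization[OF P] distr_abs_symmetrization[OF Q] by metis
qed

section \<open>Carleman's criterion on the half-line\<close>

text \<open>For \<open>w \<ge> 0\<close> the power \<open>sqrt w ^ n\<close> is at most \<open>1\<close> or at most \<open>w ^ n\<close>, according to whether \<open>w \<le> 1\<close>.\<close>

lemma (in prob_space) integrable_sqrt_power: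
  assumes [measurable]: "W \<in> borel_measurable M" and nonneg: "AE \<omega> in M. 0 \<le> W \<omega>"
    and fin: "finite_moments M W"
  shows "integrable M (\<lambda>\<omega>. sqrt (W \<omega>) ^ n)"
proof -
  have "integrable M (\<lambda>\<omega>. W \<omega> ^ n)"
    using fin by (cases "n = 0") (auto simp: finite_moments_def)
  then have "integrable M (\<lambda>\<omega>. 1 + W \<omega> ^ n)" by simp
  then show ?thesis
  proof (rule Bochner_Integration.integrable_bound)
    show "AE \<omega> in M. norm (sqrt (W \<omega>) ^ n) \<le> norm (1 + W \<omega> ^ n)"
      using nonneg
    proof (rule eventually_mono)
      fix \<omega> assume W: "0 \<le> W \<omega>"
      have "sqrt (W \<omega>) ^ n \<le> 1 + W \<omega> ^ n"
      proof (cases "W \<omega> \<le> 1")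
        case True
        then have "sqrt (W \<omega>) ^ n \<le> 1" using W by (intro power_le_one) auto
        then show ?thesis using W by (simp add: add_increasing2)
      next
        case False
        then have "sqrt (W \<omega>) ^ n \<le> W \<omega> ^ n"
          by (intro power_mono) (auto simp: real_sqrt_le_iff intro!: real_le_lsqrt simp: power2_eq_square)
        then show ?thesis by simp
      qed
      then show "norm (sqrt (W \<omega>) ^ n) \<le> norm (1 + W \<omega> ^ n)" using W by simp
    qed
  qed simp
qed

lemma real_distribution_eq_return_0:
  assumes "real_distribution N" "AE x in N. x = 0"
  shows "N = return borel 0"
proof -
  interpret real_distribution N by fact
  have "N = distr N borel (\<lambda>x. x)" by (simp add: distr_id2)
  also have "\<dots> = distr N borel (\<lambda>_. 0)" using assms(2) by (intro distr_cong_AE) auto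
  finally show ?thesis by simp
qed

text \<open>The law of \<open>sqrt W\<close> has the moments of \<open>W\<close> as its moments of even order. Two laws on the half-line with these even
moments are equal by \<open>cosine_transforms_agree\<close> and \<open>cosine_transform_unique\<close>, and squaring leads back to the law of \<open>W\<close>.
The quotients of moments behind this make sense only if \<open>W\<close> has positive mean. Otherwise \<open>W\<close> vanishes almost surely, and so
does every competitor, already because of its first moment.\<close>

theorem carleman_imp_moment_determinate:
  fixes W :: "'a \<Rightarrow> real"
  assumes "prob_space M" and W[measurable]: "W \<in> borel_measurable M"
    and nonneg: "\<forall>\<omega>\<in>space M. 0 \<le> W \<omega>" and fin: "finite_moments M W"
    and carleman: "carleman_stieltjes M W"
  shows "moment_determinate_stieltjes M W"
  unfolding moment_determinate_stieltjes_def
proof (intro conjI allI impI W nonneg fin)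
  interpret prob_space M by fact
  fix N :: "real measure"
  assume N: "real_distribution N" "AE x in N. 0 \<le> x" "finite_moments N (\<lambda>x. x)"
    and same: "\<forall>n\<ge>1. (\<integral>x. x ^ n \<partial>N) = (\<integral>\<omega>. W \<omega> ^ n \<partial>M)"
  interpret N: real_distribution N by fact
  have W_AE: "AE \<omega> in M. 0 \<le> W \<omega>" using nonneg by simp
  have W_law: "real_distribution (distr M borel W)" by (rule real_distribution_distr[OF W])
  show "N = distr M borel W"
  proof (cases "(\<integral>\<omega>. W \<omega> \<partial>M) = 0")
    case True
    have "integrable M W" "integrable N (\<lambda>x. x)"
      using fin[unfolded finite_moments_def, rule_format, of 1]
        N(3)[unfolded finite_moments_def, rule_format, of 1] by simp_all
    then have "AE \<omega> in M. W \<omega> = 0" "AE x in N. x = 0"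
      using True spec[OF same, of 1] integral_nonneg_eq_0_iff_AE[OF _ W_AE]
        integral_nonneg_eq_0_iff_AE[OF _ N(2)] by simp_all
    moreover from this(1) have "AE x in distr M borel W. x = 0"
      by (simp add: AE_distr_iff)
    ultimately have "N = return borel 0" "distr M borel W = return borel 0"
      using real_distribution_eq_return_0 N(1) W_law by blast+
    then show ?thesis by simp
  next
    case False
    define P where "P = distr M borel (\<lambda>\<omega>. sqrt (W \<omega>))"
    define Q where "Q = distr N borel sqrt"
    have P: "real_distribution P" "AE x in P. 0 \<le> x" "\<And>n. integrable P (\<lambda>x. x ^ n)"
      unfolding P_def using W_AE integrable_sqrt_power[OF W W_AE fin]
      by (auto intro!: real_distribution_distr simp: AE_distr_iff integrable_distr_eq)
    have Q: "real_distribution Q" "AE x in Q. 0 \<le> x" "\<And>n. integrable Q (\<lambda>x. x ^ n)"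
      unfolding Q_def using N(2) N.integrable_sqrt_power[OF _ N(2,3)]
      by (auto intro!: N.real_distribution_distr simp: AE_distr_iff integrable_distr_eq)
    have P_even: "(\<integral>x. x ^ (2 * n) \<partial>P) = (\<integral>\<omega>. W \<omega> ^ n \<partial>M)" for n
      unfolding P_def using nonneg
      by (subst integral_distr) (auto simp: power_mult intro!: Bochner_Integration.integral_cong)
    have "(\<integral>x. x ^ (2 * n) \<partial>Q) = (\<integral>x. x ^ n \<partial>N)" for n
      unfolding Q_def using N(2)
      by (subst integral_distr) (auto simp: power_mult intro!: integral_cong_AE)
    then have even: "(\<integral>x. x ^ (2 * n) \<partial>Q) = (\<integral>x. x ^ (2 * n) \<partial>P)" for n
      using spec[OF same, of n]
      by (cases "n = 0") (auto simp: P_even prob_space.prob_space[OF real_distribution.axioms(1)[OF P(1)]]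
          prob_space.prob_space[OF real_distribution.axioms(1)[OF Q(1)]])
    have pos: "0 < (\<integral>x. x\<^sup>2 \<partial>P)"
      using False P_even[of 1] integral_nonneg_AE[OF W_AE] by simp
    have m_pos: "0 < (\<integral>\<omega>. W \<omega> ^ n \<partial>M)" for n
      unfolding P_even[symmetric] by (rule moment_pos[OF _ P(2,3) pos]) (simp_all add: P_def)
    have diverges: "\<not> summable (\<lambda>n. (1 / (\<integral>x. x ^ (2 * Suc n) \<partial>P)) powr (1 / real (2 * Suc n)))"
      (is "\<not> summable ?s")
    proof
      assume "summable ?s"
      moreover have "inverse (ennreal ((\<integral>\<omega>. W \<omega> ^ Suc n \<partial>M) powr (1 / (2 * real (Suc n))))) = ennreal (?s n)" for n
        unfolding P_even using m_pos[of "Suc n"]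
        by (subst inverse_ennreal) (simp_all add: powr_divide inverse_eq_divide)
      ultimately show False
        using carleman unfolding carleman_stieltjes_def
        by (simp add: suminf_ennreal2 del: of_nat_Suc power_Suc)
    qed
    have "P = Q"
      by (rule cosine_transform_unique[OF P(1,2) Q(1,2)])
         (rule cosine_transforms_agree[OF P Q even pos diverges])
    have "distr M borel W = distr P borel (\<lambda>x. x\<^sup>2)"
      unfolding P_def using nonneg by (subst distr_distr) (auto simp: comp_def intro!: distr_cong)
    also have "\<dots> = distr N borel (\<lambda>x. x)"
      unfolding \<open>P = Q\<close> Q_def using N(2)
      by (subst distr_distr) (auto simp: comp_def intro!: distr_cong_AE)
    also have "\<dots> = N" by (simp add: distr_id2)
    finally show ?thesis by simp
  qed
qed

text \<open>The exponent \<open>2 * n\<close> cancels the root \<open>1 / (2 * n)\<close> in Carleman's condition. A vanishing moment makes its term infinite and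
is no obstacle.\<close>

lemma carleman_stieltjesI:
  fixes B :: "nat \<Rightarrow> real"
  assumes B_pos: "\<And>n. 0 < B n" and nonneg: "\<And>n. 0 \<le> (\<integral>\<omega>. W \<omega> ^ Suc n \<partial>M)"
    and bound: "\<And>n. (\<integral>\<omega>. W \<omega> ^ Suc n \<partial>M) \<le> B n ^ (2 * Suc n)"
    and diverges: "\<not> summable (\<lambda>n. 1 / B n)"
  shows "carleman_stieltjes M W"
proof -
  let ?m = "\<lambda>n. (\<integral>\<omega>. W \<omega> ^ Suc n \<partial>M) powr (1 / (2 * real (Suc n)))"
  have "ennreal (1 / B n) \<le> inverse (ennreal (?m n))" for n
  proof -
    have "?m n \<le> (B n ^ (2 * Suc n)) powr (1 / (2 * real (Suc n)))"
      using bound nonneg by (intro powr_mono2) auto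
    also have "\<dots> = B n powr (real (2 * Suc n) * (1 / (2 * real (Suc n))))"
      using B_pos[of n] by (simp only: powr_realpow[symmetric] powr_powr)
    also have "\<dots> = B n" using B_pos[of n] by (simp add: field_simps)
    finally have m_le: "?m n \<le> B n" .
    show ?thesis
    proof (cases "?m n = 0")
      case True
      then show ?thesis unfolding True by simp
    next
      case False
      then have m_gt: "0 < ?m n" using powr_ge_zero by (simp only: less_le) simp
      then have "1 / B n \<le> inverse (?m n)"
        unfolding inverse_eq_divide using m_le by (intro divide_left_mono mult_pos_pos B_pos) simp_all
      then show ?thesis
        unfolding inverse_ennreal[OF m_gt] by (rule ennreal_leI)
    qed
  qed
  then have "(\<Sum>n. ennreal (1 / B n)) \<le> (\<Sum>n. inverse (ennreal (?m n)))"
    by (intro suminf_le) auto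
  moreover have "(\<Sum>n. ennreal (1 / B n)) = \<top>"
  proof (rule ccontr)
    assume "(\<Sum>n. ennreal (1 / B n)) \<noteq> \<top>"
    then have "summable (\<lambda>n. 1 / B n)"
      by (rule summable_suminf_not_top[rotated]) (simp add: less_imp_le B_pos)
    with diverges show False ..
  qed
  ultimately have "(\<Sum>n. inverse (ennreal (?m n))) = \<top>"
    by (metis top.extremum_unique)
  then show ?thesis
    unfolding carleman_stieltjes_def by (simp only: infinity_ennreal_def)
qed

text \<open>Cauchy condensation reduces this to the harmonic series. The shift by \<open>2\<close> keeps the logarithm at least \<open>1\<close>.\<close>

lemma not_summable_inverse_n_ln:
  "\<not> summable (\<lambda>n. 1 / (real (Suc n) * ln (real (Suc n) + 2)))"
proof
  \<comment> \<open>The term \<open>f 0\<close> is \<open>0\<close> by division by zero, and condensation compares only positive indices.\<close>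
  define f where "f n = 1 / (real n * ln (real n + 2))" for n
  assume "summable (\<lambda>n. 1 / (real (Suc n) * ln (real (Suc n) + 2)))"
  then have "summable f"
    by (subst (asm) f_def[symmetric]) (simp add: summable_Suc_iff)
  moreover have "summable f \<longleftrightarrow> summable (\<lambda>n. 2 ^ n * f (2 ^ n))"
  proof (rule condensation_test)
    fix m :: nat assume "0 < m"
    then show "f (Suc m) \<le> f m"
      unfolding f_def by (intro divide_left_mono mult_mono mult_pos_pos) auto
  next
    show "0 \<le> f n" for n by (auto simp: f_def)
  qed
  ultimately have "summable (\<lambda>n. 2 ^ n * f (2 ^ n))" by simp
  moreover have "norm (inverse (ln 2) * inverse (real (n + 2))) \<le> 2 ^ n * f (2 ^ n)" for n
  proof -
    have "(1::real) \<le> 2 ^ n" by (rule one_le_power) simp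
    then have "(2::real) ^ n + 2 \<le> 2 ^ (n + 2)" unfolding power_add power2_eq_square by linarith
    then have "ln ((2::real) ^ n + 2) \<le> ln (2 ^ (n + 2))"
      by (subst ln_le_cancel_iff) (auto intro: add_pos_pos)
    also have "\<dots> = real (n + 2) * ln 2" by (simp add: ln_realpow del: power_Suc power_add)
    finally have "ln ((2::real) ^ n + 2) \<le> real (n + 2) * ln 2" .
    moreover have "0 < ln ((2::real) ^ n + 2)"
      using zero_le_power[of "2::real" n] by (intro ln_gt_zero) linarith
    ultimately have "inverse (real (n + 2) * ln 2) \<le> inverse (ln ((2::real) ^ n + 2))"
      by (intro le_imp_inverse_le)
    then show ?thesis by (simp add: f_def inverse_eq_divide mult.commute)
  qed
  ultimately have "summable (\<lambda>n. inverse (ln 2) * inverse (real (n + 2)))"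
    by (rule summable_comparison_test'[where N=0])
  then have "summable (\<lambda>n. inverse (real (n + 2)))"
    by (simp add: summable_cmult_iff)
  then show False
    using not_summable_harmonic[where 'a=real] summable_iff_shift[of "\<lambda>n. inverse (real n)" 2] by simp
qed

section \<open>Moments of a density that decays under the shift\<close>

text \<open>The inverse of \<open>x + \<phi> x\<close>, in the form in which the derivative of the defect applies to it.\<close>

definition shift_inverse :: "real \<Rightarrow> (real \<Rightarrow> real) \<Rightarrow> real \<Rightarrow> real" where
  "shift_inverse x0 \<phi> y = y - shift_defect x0 \<phi> y"

lemma shift_inverse_eq: "shift_inverse x0 \<phi> = the_inv_into {x0..} (\<lambda>x. x + \<phi> x)"
  by (simp add: shift_inverse_def shift_defect_def fun_eq_iff)

lemma
  assumes "admissible_shift x0 \<phi>"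
  shows shift_inverse_shift: "x0 \<le> x \<Longrightarrow> shift_inverse x0 \<phi> (x + \<phi> x) = x"
    and shift_inverse_ge: "x0 + \<phi> x0 \<le> y \<Longrightarrow> x0 \<le> shift_inverse x0 \<phi> y"
    and shift_shift_inverse:
      "x0 + \<phi> x0 \<le> y \<Longrightarrow> shift_inverse x0 \<phi> y + \<phi> (shift_inverse x0 \<phi> y) = y"
proof -
  let ?h = "\<lambda>x. x + \<phi> x"
  have nonneg: "\<And>x. x0 \<le> x \<Longrightarrow> 0 \<le> \<phi> x" and diff: "\<phi> differentiable_on {x0..}"
    and mono: "strict_mono_on {x0..} ?h"
    using assms unfolding admissible_shift_def by auto
  have inj: "inj_on ?h {x0..}" using mono by (rule strict_mono_on_imp_inj_on)
  have cont: "continuous_on {x0..} ?h"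
    by (intro continuous_intros differentiable_imp_continuous_on diff)
  have onto: "y \<in> ?h ` {x0..}" if y: "?h x0 \<le> y" for y
  proof -
    have "x0 \<le> y" using y nonneg[of x0] by simp
    then obtain x where "x0 \<le> x" "?h x = y"
      using IVT'[of ?h x0 y y] y nonneg[of y] continuous_on_subset[OF cont, of "{x0..y}"] by auto
    then show ?thesis by auto
  qed
  show "shift_inverse x0 \<phi> (x + \<phi> x) = x" if "x0 \<le> x"
    unfolding shift_inverse_eq using the_inv_into_f_f[OF inj, of x] that by simp
  show "x0 \<le> shift_inverse x0 \<phi> y" if "?h x0 \<le> y"
    unfolding shift_inverse_eq using the_inv_into_into[OF inj onto[OF that] order_refl] by simp
  show "shift_inverse x0 \<phi> y + \<phi> (shift_inverse x0 \<phi> y) = y" if "?h x0 \<le> y"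
    unfolding shift_inverse_eq using f_the_inv_into_f[OF inj onto[OF that]] by simp
qed

lemma shift_inverse_image:
  assumes "admissible_shift x0 \<phi>" "x0 + \<phi> x0 \<le> b"
  shows "shift_inverse x0 \<phi> ` {b..} = {shift_inverse x0 \<phi> b..}"
proof -
  have mono: "strict_mono_on {x0..} (\<lambda>x. x + \<phi> x)"
    using assms unfolding admissible_shift_def by auto
  note ge = shift_inverse_ge[OF assms(1)] and inv = shift_shift_inverse[OF assms(1)]
  have "shift_inverse x0 \<phi> b \<le> shift_inverse x0 \<phi> y" if "b \<le> y" for y
  proof (rule ccontr)
    assume "\<not> ?thesis"
    then have "y < b"
      using strict_mono_onD[OF mono, of "shift_inverse x0 \<phi> y" "shift_inverse x0 \<phi> b"]
        ge[of y] ge[of b] inv[of y] inv[of b] assms(2) that by simp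
    with that show False by simp
  qed
  moreover have "x \<in> shift_inverse x0 \<phi> ` {b..}" if "shift_inverse x0 \<phi> b \<le> x" for x
  proof -
    have "x0 \<le> x" using ge[OF assms(2)] that by simp
    moreover have "b \<le> x + \<phi> x"
      using monotone_onD[OF strict_mono_on_imp_mono_on[OF mono], of "shift_inverse x0 \<phi> b" x]
        ge[OF assms(2)] inv[OF assms(2)] that \<open>x0 \<le> x\<close> by simp
    ultimately show ?thesis
      using shift_inverse_shift[OF assms(1), of x] by (auto intro!: image_eqI[of _ _ "x + \<phi> x"])
  qed
  ultimately show ?thesis by auto
qed

text \<open>The change of variables below is a statement about absolute integrals over subsets of the real line. This lemma expresses
the tails of the moments as such integrals; below \<open>x0\<close> the measure may have no density.\<close>

lemma tail_moment_eq_integral: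
  fixes \<mu> :: "real measure"
  assumes sets[measurable_cong]: "sets \<mu> = sets borel"
    and g: "g \<in> borel_measurable (restrict_space borel {x0..})" "\<forall>x\<ge>x0. 0 \<le> g x"
    and dens: "restrict_space \<mu> {x0..} = density (restrict_space lborel {x0..}) (\<lambda>x. ennreal (g x))"
    and int: "integrable \<mu> (\<lambda>x. x ^ n)" and "x0 \<le> c"
  shows "(\<lambda>x. x ^ n * g x) absolutely_integrable_on {c..}"
    and "(\<integral>x. indicator {c..} x * x ^ n \<partial>\<mu>) = integral {c..} (\<lambda>x. x ^ n * g x)"
proof -
  let ?R = "restrict_space lborel {x0..}"
  let ?h = "\<lambda>x. indicator {c..} x * x ^ n :: real"
  have space: "space \<mu> = UNIV" using sets_eq_imp_space_eq[OF sets] by simp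
  have h_meas: "?h \<in> borel_measurable ?R" by (intro measurable_restrict_space1) simp
  have g_meas: "g \<in> borel_measurable ?R" using g(1) by (simp cong: measurable_cong_sets add: sets_restrict_space)
  have g_nonneg: "AE x in ?R. 0 \<le> g x" using g(2) by (auto simp: space_restrict_space)
  have h_int: "integrable \<mu> ?h"
    using integrable_mult_indicator[OF _ int, of "{c..}"] sets by simp
  have indicators: "indicator {x0..} x *\<^sub>R ?h x = ?h x"
    "indicator {x0..} x *\<^sub>R (g x *\<^sub>R ?h x) = indicator {c..} x *\<^sub>R (x ^ n * g x)" for x
    using \<open>x0 \<le> c\<close> by (auto simp: indicator_def)
  have "integrable (restrict_space \<mu> {x0..}) ?h"
    using h_int sets space by (subst integrable_restrict_space) (simp_all only: indicators, simp_all)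
  then have "integrable ?R (\<lambda>x. g x *\<^sub>R ?h x)"
    unfolding dens by (subst (asm) integrable_density[OF h_meas g_meas g_nonneg])
  then have si: "set_integrable lborel {c..} (\<lambda>x. x ^ n * g x)"
    unfolding set_integrable_def
    by (subst (asm) integrable_restrict_space) (simp_all only: indicators, simp_all)
  then show "(\<lambda>x. x ^ n * g x) absolutely_integrable_on {c..}"
    unfolding set_integrable_def by (subst integrable_completion) (auto simp: borel_measurable_integrable)
  have "(\<integral>x. ?h x \<partial>\<mu>) = (\<integral>x. ?h x \<partial>restrict_space \<mu> {x0..})"
    using sets space by (subst integral_restrict_space) (simp_all only: indicators, simp_all)
  also have "\<dots> = (\<integral>x. g x *\<^sub>R ?h x \<partial>?R)"
    unfolding dens by (rule integral_density[OF h_meas g_meas g_nonneg])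
  also have "\<dots> = (LINT x:{c..}|lborel. x ^ n * g x)"
    unfolding set_lebesgue_integral_def
    by (subst integral_restrict_space) (simp_all only: indicators, simp_all)
  also have "\<dots> = integral {c..} (\<lambda>x. x ^ n * g x)"
    using si by (rule set_borel_integral_eq_integral)
  finally show "(\<integral>x. ?h x \<partial>\<mu>) = integral {c..} (\<lambda>x. x ^ n * g x)" .
qed

text \<open>The scale \<open>n * ln n\<close> arises here: up to a constant, it is the least one from which on \<open>n * ln y\<close> is small compared with \<open>y\<close>. If
\<open>n \<le> sqrt y\<close>, this holds because \<open>sqrt y * ln y\<close> is small compared with \<open>y\<close>. If \<open>n > sqrt y\<close>, then \<open>ln y\<close> is at most
\<open>2 * ln (n + 2)\<close>, and a large \<open>K\<close> suffices.\<close>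

lemma n_ln_threshold:
  fixes \<delta> Y :: real
  assumes "0 < \<delta>"
  shows "\<exists>K\<ge>1. \<forall>n\<ge>1. \<forall>y\<ge>K * (real n * ln (real n + 2)). Y \<le> y \<and> real n * ln y \<le> \<delta> * y"
proof -
  have "eventually (\<lambda>y. sqrt y * ln y \<le> \<delta> * y) at_top"
    using assms by real_asymp
  then obtain Z where Z: "\<And>y. Z \<le> y \<Longrightarrow> sqrt y * ln y \<le> \<delta> * y"
    by (auto simp: eventually_at_top_linorder)
  define K where "K = Max {1, Y, Z, 2 / \<delta>}"
  have K: "1 \<le> K" "Y \<le> K" "Z \<le> K" "2 / \<delta> \<le> K" by (simp_all add: K_def)
  have "Y \<le> y \<and> real n * ln y \<le> \<delta> * y" if n: "1 \<le> n" and y: "K * (real n * ln (real n + 2)) \<le> y" for n :: nat and y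
  proof -
    have "exp 1 \<le> real n + 2" using exp_le n by simp
    then have ln_ge: "1 \<le> ln (real n + 2)"
      using n by (subst ln_ge_iff) auto
    then have "1 * 1 \<le> real n * ln (real n + 2)" using n by (intro mult_mono) auto
    then have "K * 1 \<le> K * (real n * ln (real n + 2))" using K by (intro mult_left_mono) auto
    then have "K \<le> y" using y by simp
    have "real n * ln y \<le> \<delta> * y"
    proof (cases "real n \<le> sqrt y")
      case True
      then have "real n * ln y \<le> sqrt y * ln y"
        using \<open>K \<le> y\<close> K by (intro mult_right_mono) auto
      also have "\<dots> \<le> \<delta> * y" using Z \<open>K \<le> y\<close> K by auto
      finally show ?thesis .
    next
      case False
      have "y = (sqrt y)\<^sup>2" using \<open>K \<le> y\<close> K by simp
      also have "\<dots> \<le> (real n + 2)\<^sup>2" using False \<open>K \<le> y\<close> K by (intro power_mono) auto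
      finally have "ln y \<le> ln ((real n + 2)\<^sup>2)"
        using \<open>K \<le> y\<close> K by (subst ln_le_cancel_iff) auto
      also have "\<dots> = 2 * ln (real n + 2)" by (simp add: ln_realpow)
      finally have "real n * ln y \<le> real n * (2 * ln (real n + 2))" by (intro mult_left_mono) auto
      also have "\<dots> = \<delta> * (2 / \<delta> * (real n * ln (real n + 2)))" using assms by simp
      also have "\<dots> \<le> \<delta> * (K * (real n * ln (real n + 2)))"
        using assms K ln_ge by (intro mult_left_mono mult_right_mono) auto
      also have "\<dots> \<le> \<delta> * y" using assms y by (intro mult_left_mono) auto
      finally show ?thesis .
    qed
    then show ?thesis using K \<open>K \<le> y\<close> by auto
  qed
  then show ?thesis using K by blast
qed

text \<open>Beyond the threshold two factors are close to \<open>1\<close>, uniformly in \<open>n\<close>, and cannot spoil the gain \<open>q < 1\<close> of one shift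
of the density. With \<open>u = X y\<close> and \<open>d = y - u \<le> C * ln y\<close>, the quotient \<open>(y / u) ^ n\<close> is at most \<open>exp (n * d / u)\<close>,
where \<open>n * d / u\<close> is at most a multiple of \<open>n * ln y / y\<close>; and the derivative \<open>X' y = 1 - D y\<close> is at least
\<open>1 - C / y\<close>. With \<open>q \<le> s ^ 3\<close>, one factor \<open>s\<close> pays for the power, one for the derivative, and one remains.\<close>

lemma pointwise_contraction:
  assumes adm: "admissible_shift x0 \<phi>" and g_pos: "\<And>x. x0 \<le> x \<Longrightarrow> 0 < g x"
    and lim: "Limsup at_top (\<lambda>x. ereal (g (x + \<phi> x) / g x)) < 1"
  defines "X \<equiv> shift_inverse x0 \<phi>"
  shows "\<exists>s>0. s < 1 \<and> (\<exists>K\<ge>1. \<exists>X'. \<forall>n\<ge>1. \<forall>y\<ge>K * (real n * ln (real n + 2)).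
    x0 + \<phi> x0 \<le> y \<and> (X has_real_derivative X' y) (at y within {x0 + \<phi> x0..}) \<and> 0 \<le> X' y \<and>
    y ^ n * g y \<le> s * (X' y * (X y ^ n * g (X y))))"
proof -
  from adm obtain C ys D where "0 < C" and ys: "x0 + \<phi> x0 \<le> ys"
    and D_deriv: "\<And>y. ys \<le> y \<Longrightarrow> (shift_defect x0 \<phi> has_real_derivative D y) (at y within {x0 + \<phi> x0..})"
    and D_range: "\<And>y. ys \<le> y \<Longrightarrow> D y \<le> 1"
    and defect_le: "\<And>y. ys \<le> y \<Longrightarrow> shift_defect x0 \<phi> y \<le> C * ln y"
    and D_le: "\<And>y. ys \<le> y \<Longrightarrow> y * D y \<le> C"
    and phi_nonneg: "\<And>x. x0 \<le> x \<Longrightarrow> 0 \<le> \<phi> x"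
    unfolding admissible_shift_def by force
  obtain q where "Limsup at_top (\<lambda>x. ereal (g (x + \<phi> x) / g x)) < ereal q" "ereal q < 1"
    using ereal_dense2[OF lim] by auto
  then have "eventually (\<lambda>x. ereal (g (x + \<phi> x) / g x) < ereal q) at_top" "q < 1"
    by (auto dest: Limsup_lessD)
  then obtain x1 where x1: "\<And>x. x1 \<le> x \<Longrightarrow> g (x + \<phi> x) / g x < q"
    by (auto simp: eventually_at_top_linorder)
  \<comment> \<open>The maximum with \<open>1/2\<close> keeps \<open>s\<close> positive for any \<open>q\<close>.\<close>
  define s where "s = root 3 (max q (1/2))"
  have s: "0 < s" "s < 1" "q \<le> s ^ 3"
    using \<open>q < 1\<close> by (auto simp: s_def real_root_lt_1_iff)
  \<comment> \<open>If \<open>n * ln y \<le> \<delta> * y\<close>, then \<open>exp (2 * C * n * ln y / y) \<le> 1 / s\<close>.\<close>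
  define \<delta> where "\<delta> = - ln s / (2 * C)"
  have \<delta>: "0 < \<delta>" using s \<open>0 < C\<close> by (simp add: \<delta>_def divide_neg_pos)
  have "eventually (\<lambda>y. C * ln y \<le> y / 2) at_top"
    by real_asymp
  then obtain Z where Z: "\<And>y. Z \<le> y \<Longrightarrow> C * ln y \<le> y / 2"
    by (auto simp: eventually_at_top_linorder)
  obtain K where K: "1 \<le> K" and thr: "\<And>n y. 1 \<le> n \<Longrightarrow> K * (real n * ln (real n + 2)) \<le> y \<Longrightarrow>
      Max {ys, 1, Z, 2 * x0, 2 * x1, C / (1 - s)} \<le> y \<and> real n * ln y \<le> \<delta> * y"
    using n_ln_threshold[OF \<delta>] by metis
  have main: "x0 + \<phi> x0 \<le> y \<and> (X has_real_derivative 1 - D y) (at y within {x0 + \<phi> x0..}) \<and> 0 \<le> 1 - D y \<and>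
    y ^ n * g y \<le> s * ((1 - D y) * (X y ^ n * g (X y)))"
    if n: "1 \<le> n" and y_ge: "K * (real n * ln (real n + 2)) \<le> y" for n :: nat and y
  proof -
    have y: "ys \<le> y" "1 \<le> y" "Z \<le> y" "2 * x0 \<le> y" "2 * x1 \<le> y" "C / (1 - s) \<le> y"
      and n_ln: "real n * ln y \<le> \<delta> * y"
      using thr[OF n y_ge] by auto
    define u where "u = X y"
    define d where "d = shift_defect x0 \<phi> y"
    have u: "x0 \<le> u" "u + \<phi> u = y" "u = y - d"
      using shift_inverse_ge[OF adm] shift_shift_inverse[OF adm] y(1) ys
      by (auto simp: u_def X_def d_def shift_inverse_def)
    have d: "0 \<le> d" "d \<le> C * ln y" "d \<le> y / 2"
      using u phi_nonneg[OF u(1)] defect_le[OF y(1)] Z[OF y(3)] by (auto simp: d_def)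
    have u_pos: "0 < u" "y / 2 \<le> u" "x1 \<le> u" using u(3) d y by auto
    have g_u: "0 < g u" using g_pos u(1) by simp
    have "g y \<le> q * g u"
      using x1[OF u_pos(3)] g_u u(2) by (simp add: pos_divide_less_eq)
    also have "\<dots> \<le> s ^ 3 * g u" using s(3) g_u by (intro mult_right_mono) auto
    finally have g_le: "g y \<le> s ^ 3 * g u" .
    have "real n * (d / u) \<le> real n * (C * ln y / (y / 2))"
      using d u_pos y \<open>0 < C\<close> by (intro mult_left_mono frac_le) auto
    also have "\<dots> = 2 * C / y * (real n * ln y)" by simp
    also have "\<dots> \<le> 2 * C / y * (\<delta> * y)"
      using n_ln \<open>0 < C\<close> y by (intro mult_left_mono) auto
    also have "\<dots> = - ln s" using \<open>0 < C\<close> y by (simp add: \<delta>_def)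
    finally have exponent: "real n * (d / u) \<le> - ln s" .
    have "y ^ n = u ^ n * (1 + d / u) ^ n"
      using u_pos u(3) by (simp add: power_mult_distrib[symmetric] distrib_left)
    also have "(1 + d / u) ^ n \<le> exp (d / u) ^ n"
      using d u_pos by (intro power_mono exp_ge_add_one_self) auto
    also have "exp (d / u) ^ n = exp (real n * (d / u))" by (rule exp_of_nat_mult[symmetric])
    also have "\<dots> \<le> exp (- ln s)" using exponent by simp
    also have "\<dots> = 1 / s" using s by (simp add: exp_minus inverse_eq_divide)
    finally have y_pow: "y ^ n \<le> u ^ n * (1 / s)" using u_pos by simp
    have "C \<le> (1 - s) * y" using y(6) s by (simp add: pos_divide_le_eq mult.commute)
    then have "y * D y \<le> y * (1 - s)" using D_le[OF y(1)] by (simp add: mult.commute)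
    then have slope: "s \<le> 1 - D y" using y(2) by simp
    have "y ^ n * g y \<le> (u ^ n * (1 / s)) * (s ^ 3 * g u)"
      using s u_pos g_pos[of y] u d by (intro mult_mono y_pow g_le) (simp_all add: less_imp_le)
    also have "\<dots> = s * (s * (u ^ n * g u))"
      using s by (simp add: power3_eq_cube)
    also have "\<dots> \<le> s * ((1 - D y) * (u ^ n * g u))"
      using s slope u_pos g_u by (intro mult_left_mono mult_right_mono) auto
    finally have "y ^ n * g y \<le> s * ((1 - D y) * (u ^ n * g u))" .
    moreover have "(X has_real_derivative 1 - D y) (at y within {x0 + \<phi> x0..})"
      unfolding X_def shift_inverse_def[abs_def] by (intro DERIV_diff DERIV_ident D_deriv y)
    ultimately show ?thesis using D_range[OF y(1)] y ys by (simp add: u_def)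
  qed
  show ?thesis
    using s K main by (intro exI[of _ s] exI[of _ K] exI[of _ "\<lambda>y. 1 - D y"] conjI allI impI) auto
qed

text \<open>Let \<open>T c\<close> be the part of the \<open>n\<close>-th moment carried by \<open>{c..}\<close>, and let \<open>b\<close> be the threshold of order \<open>n * ln n\<close>. Integrating
the pointwise contraction over \<open>{b..}\<close> and substituting \<open>x = X y\<close> gives \<open>T b \<le> s * T (X b)\<close>, which is at most \<open>s\<close> times the
whole moment. The rest of the moment is at most \<open>b ^ n\<close>, because it comes from arguments below \<open>b\<close>. The moment is finite, so
it can be absorbed: it is at most \<open>b ^ n / (1 - s)\<close>.\<close>

lemma moment_growth:
  fixes \<mu> :: "real measure"
  assumes "real_distribution \<mu>" and nonneg: "AE x in \<mu>. 0 \<le> x"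
    and int: "\<And>n. integrable \<mu> (\<lambda>x. x ^ n)" and adm: "admissible_shift x0 \<phi>"
    and g_meas: "g \<in> borel_measurable (restrict_space borel {x0..})"
    and g_pos: "\<And>x. x0 \<le> x \<Longrightarrow> 0 < g x"
    and dens: "restrict_space \<mu> {x0..} = density (restrict_space lborel {x0..}) (\<lambda>x. ennreal (g x))"
    and lim: "Limsup at_top (\<lambda>x. ereal (g (x + \<phi> x) / g x)) < 1"
  shows "\<exists>c\<ge>1. \<forall>n\<ge>1. (\<integral>x. x ^ n \<partial>\<mu>) \<le> (c * (real n * ln (real n + 2))) ^ n"
proof -
  interpret real_distribution \<mu> by fact
  define X where "X = shift_inverse x0 \<phi>"
  obtain s K X' where s: "0 < s" "s < 1" and "1 \<le> K"
    and above: "\<And>n y. 1 \<le> n \<Longrightarrow> K * (real n * ln (real n + 2)) \<le> y \<Longrightarrow> x0 + \<phi> x0 \<le> y"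
    and deriv: "\<And>n y. 1 \<le> n \<Longrightarrow> K * (real n * ln (real n + 2)) \<le> y \<Longrightarrow>
      (X has_real_derivative X' y) (at y within {x0 + \<phi> x0..})"
    and slope: "\<And>n y. 1 \<le> n \<Longrightarrow> K * (real n * ln (real n + 2)) \<le> y \<Longrightarrow> 0 \<le> X' y"
    and contract: "\<And>n y. 1 \<le> n \<Longrightarrow> K * (real n * ln (real n + 2)) \<le> y \<Longrightarrow>
      y ^ n * g y \<le> s * (X' y * (X y ^ n * g (X y)))"
    using pointwise_contraction[OF adm g_pos lim] unfolding X_def by blast
  have "(\<integral>x. x ^ n \<partial>\<mu>) \<le> (K / (1 - s) * (real n * ln (real n + 2))) ^ n" if n: "1 \<le> n" for n :: nat
  proof -
    define b where "b = K * (real n * ln (real n + 2))"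
    let ?f = "\<lambda>x. x ^ n * g x"
    define T where "T c = (\<integral>x. indicator {c..} x * x ^ n \<partial>\<mu>)" for c
    have b: "0 \<le> b" "x0 + \<phi> x0 \<le> b"
      using \<open>1 \<le> K\<close> above[OF n] by (auto simp: b_def)
    have X_b: "x0 \<le> X b" unfolding X_def by (rule shift_inverse_ge[OF adm b(2)])
    have "x0 \<le> b" using b(2) adm unfolding admissible_shift_def by force
    have "\<forall>x\<ge>x0. 0 \<le> g x" using g_pos by (auto simp: less_imp_le)
    note tail = tail_moment_eq_integral[OF events_eq_borel g_meas this dens int]
    have int_T: "integrable \<mu> (\<lambda>x. indicator {c..} x * x ^ n)" for c
      using integrable_mult_indicator[OF _ int, of "{c..}"] by simp
    have "inj_on X {b..}"
      by (rule inj_on_inverseI[where g="\<lambda>x. x + \<phi> x"])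
         (use shift_shift_inverse[OF adm] b(2) in \<open>auto simp: X_def\<close>)
    moreover have "(X has_real_derivative X' y) (at y within {b..})" if "y \<in> {b..}" for y
      using deriv[OF n, of y] that b(2) by (auto simp: b_def intro: DERIV_subset)
    ultimately have subst: "(\<lambda>y. \<bar>X' y\<bar> * ?f (X y)) absolutely_integrable_on {b..}"
        "integral {b..} (\<lambda>y. \<bar>X' y\<bar> * ?f (X y)) = integral {X b..} ?f"
      using has_absolute_integral_change_of_variables_1'[of "{b..}" X X' ?f "integral {X b..} ?f"]
        tail(1)[OF X_b, of n] shift_inverse_image[OF adm b(2)] by (simp_all add: X_def)
    have "T b = integral {b..} ?f" unfolding T_def by (rule tail(2)[OF \<open>x0 \<le> b\<close>])
    also have "\<dots> \<le> integral {b..} (\<lambda>y. s * (\<bar>X' y\<bar> * ?f (X y)))"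
    proof (rule integral_le)
      show "?f integrable_on {b..}"
        using tail(1)[OF \<open>x0 \<le> b\<close>] by (rule set_lebesgue_integral_eq_integral)
      show "(\<lambda>y. s * (\<bar>X' y\<bar> * ?f (X y))) integrable_on {b..}"
        using set_lebesgue_integral_eq_integral(1)[OF subst(1)] by (rule integrable_on_mult_right)
      show "?f y \<le> s * (\<bar>X' y\<bar> * ?f (X y))" if "y \<in> {b..}" for y
        using contract[OF n, of y] slope[OF n, of y] that by (simp add: b_def)
    qed
    also have "\<dots> = s * T (X b)"
      unfolding T_def tail(2)[OF X_b] subst(2)[symmetric] by (rule integral_mult_right)
    also have "\<dots> \<le> s * (\<integral>x. x ^ n \<partial>\<mu>)"
    proof (intro mult_left_mono less_imp_le[OF s(1)])
      show "T (X b) \<le> (\<integral>x. x ^ n \<partial>\<mu>)"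
        unfolding T_def
        by (rule integral_mono_AE[OF int_T int])
           (rule eventually_mono[OF nonneg], auto simp: indicator_def)
    qed
    finally have T_b: "T b \<le> s * (\<integral>x. x ^ n \<partial>\<mu>)" .
    have "(\<integral>x. x ^ n \<partial>\<mu>) \<le> (\<integral>x. b ^ n + indicator {b..} x * x ^ n \<partial>\<mu>)"
    proof (rule integral_mono_AE[OF int])
      show "AE x in \<mu>. x ^ n \<le> b ^ n + indicator {b..} x * x ^ n"
        by (rule eventually_mono[OF nonneg]) (use b in \<open>auto simp: indicator_def intro: power_mono\<close>)
    qed (use int_T in simp)
    also have "\<dots> = b ^ n + T b"
      using int_T by (simp add: T_def prob_space[unfolded space_eq_univ])
    finally have "(\<integral>x. x ^ n \<partial>\<mu>) \<le> b ^ n + s * (\<integral>x. x ^ n \<partial>\<mu>)" using T_b by linarith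
    then have "(\<integral>x. x ^ n \<partial>\<mu>) \<le> b ^ n * (1 / (1 - s))"
      using s by (simp add: pos_le_divide_eq algebra_simps)
    also have "\<dots> \<le> b ^ n * (1 / (1 - s)) ^ n"
      using s n b by (intro mult_left_mono self_le_power) auto
    also have "\<dots> = (K / (1 - s) * (real n * ln (real n + 2))) ^ n"
      by (simp add: b_def power_mult_distrib[symmetric])
    finally show ?thesis .
  qed
  moreover have "1 \<le> K / (1 - s)" using s \<open>1 \<le> K\<close> by (simp add: pos_le_divide_eq)
  ultimately show ?thesis by blast
qed

lemma not_summable_inverse_const_n_ln:
  assumes "0 < c"
  shows "\<not> summable (\<lambda>n. 1 / (c * (real (Suc n) * ln (real (Suc n) + 2))))"
proof -
  have "(\<lambda>n. 1 / (c * (real (Suc n) * ln (real (Suc n) + 2))))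
      = (\<lambda>n. (1 / c) * (1 / (real (Suc n) * ln (real (Suc n) + 2))))" by simp
  then show ?thesis
    using not_summable_inverse_n_ln assms by (simp only: summable_cmult_iff) simp
qed

section \<open>Carleman's condition and determinacy for the variable and its square\<close>

theorem theorem3:
  fixes M :: "'a measure" and Y :: "'a \<Rightarrow> real"
    and \<phi> g :: "real \<Rightarrow> real" and x0 :: real
  assumes "prob_space M"
    and "x0 > 0"
    and "admissible_shift x0 \<phi>"
    and "Y \<in> borel_measurable M"
    and "\<forall>\<omega>\<in>space M. 0 \<le> Y \<omega>"
    and "finite_moments M Y"
    and "g \<in> borel_measurable (restrict_space borel {x0..})"
    and "\<forall>x\<ge>x0. g x > 0"
    and "restrict_space (distr M borel Y) {x0..} =
           density (restrict_space lborel {x0..}) (\<lambda>x. ennreal (g x))"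
    and "Limsup at_top (\<lambda>x. ereal (g (x + \<phi> x) / g x)) < 1"
  shows "carleman_stieltjes M Y \<and> carleman_stieltjes M (\<lambda>\<omega>. (Y \<omega>)\<^sup>2) \<and>
         moment_determinate_stieltjes M Y \<and>
         moment_determinate_stieltjes M (\<lambda>\<omega>. (Y \<omega>)\<^sup>2)"
proof -
  interpret prob_space M by fact
  note [measurable] = \<open>Y \<in> borel_measurable M\<close>
  have int: "integrable M (\<lambda>\<omega>. Y \<omega> ^ n)" for n
    using \<open>finite_moments M Y\<close> by (cases "n = 0") (auto simp: finite_moments_def)
  have "\<exists>c\<ge>1. \<forall>n\<ge>1. (\<integral>x. x ^ n \<partial>distr M borel Y) \<le> (c * (real n * ln (real n + 2))) ^ n"
  proof (rule moment_growth)
    show "real_distribution (distr M borel Y)"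
      by (rule real_distribution_distr[OF assms(4)])
    show "AE x in distr M borel Y. 0 \<le> x" using assms(5) by (simp add: AE_distr_iff)
    show "integrable (distr M borel Y) (\<lambda>x. x ^ n)" for n
      using int by (simp add: integrable_distr_eq)
  qed (use assms in auto)
  then obtain c where c: "1 \<le> c"
    and growth: "\<And>n. 1 \<le> n \<Longrightarrow> (\<integral>\<omega>. Y \<omega> ^ n \<partial>M) \<le> (c * (real n * ln (real n + 2))) ^ n"
    by (auto simp: integral_distr)
  define L where "L n = real (Suc n) * ln (real (Suc n) + 2)" for n
  have L: "1 \<le> L n" for n
  proof -
    have "exp 1 \<le> real (Suc n) + 2" using exp_le by simp
    then have "1 \<le> ln (real (Suc n) + 2)" by (subst ln_ge_iff) auto
    then have "1 * 1 \<le> L n" unfolding L_def by (intro mult_mono) auto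
    then show ?thesis by simp
  qed
  have cL: "1 \<le> c * L n" for n using mult_mono[OF c L[of n]] c by simp
  have moments_nonneg: "0 \<le> (\<integral>\<omega>. Y \<omega> ^ n \<partial>M)" for n
    using assms(5) by (intro integral_nonneg_AE) auto
  have carleman: "carleman_stieltjes M Y"
  proof (rule carleman_stieltjesI)
    show "0 < c * L n" for n using cL[of n] by simp
    show "(\<integral>\<omega>. Y \<omega> ^ Suc n \<partial>M) \<le> (c * L n) ^ (2 * Suc n)" for n
    proof -
      have "(\<integral>\<omega>. Y \<omega> ^ Suc n \<partial>M) \<le> (c * L n) ^ Suc n"
        using growth[of "Suc n"] by (simp only: L_def)
      also have "\<dots> \<le> (c * L n) ^ (2 * Suc n)"
        using cL by (intro power_increasing) auto
      finally show ?thesis .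
    qed
    show "\<not> summable (\<lambda>n. 1 / (c * L n))"
      unfolding L_def using c by (intro not_summable_inverse_const_n_ln) simp
  qed (rule moments_nonneg)
  have carleman_sq: "carleman_stieltjes M (\<lambda>\<omega>. (Y \<omega>)\<^sup>2)"
  proof (rule carleman_stieltjesI)
    show "0 < 4 * c * L n" for n using cL[of n] by simp
    show "(\<integral>\<omega>. ((Y \<omega>)\<^sup>2) ^ Suc n \<partial>M) \<le> (4 * c * L n) ^ (2 * Suc n)" for n
    proof -
      let ?k = "2 * Suc n"
      \<comment> \<open>Passing from order \<open>n\<close> to order \<open>2 * n\<close> at most doubles the logarithm.\<close>
      have "real ?k + 2 \<le> (real (Suc n) + 2)\<^sup>2"
        by (simp add: power2_eq_square algebra_simps)
      then have "ln (real ?k + 2) \<le> ln ((real (Suc n) + 2)\<^sup>2)"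
        by (subst ln_le_cancel_iff) simp_all
      also have "\<dots> = 2 * ln (real (Suc n) + 2)" by (simp add: ln_realpow)
      finally have "real ?k * ln (real ?k + 2) \<le> real ?k * (2 * ln (real (Suc n) + 2))"
        by (intro mult_left_mono) auto
      also have "\<dots> = 4 * L n" by (simp add: L_def)
      finally have "c * (real ?k * ln (real ?k + 2)) \<le> 4 * c * L n" using c by simp
      moreover have "0 \<le> c * (real ?k * ln (real ?k + 2))" using c by (intro mult_nonneg_nonneg) auto
      ultimately have "(c * (real ?k * ln (real ?k + 2))) ^ ?k \<le> (4 * c * L n) ^ ?k"
        by (intro power_mono)
      moreover have "(\<integral>\<omega>. Y \<omega> ^ ?k \<partial>M) \<le> (c * (real ?k * ln (real ?k + 2))) ^ ?k"
        by (rule growth) simp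
      ultimately show ?thesis unfolding power_mult[symmetric] by linarith
    qed
    show "\<not> summable (\<lambda>n. 1 / (4 * c * L n))"
      unfolding L_def using c by (intro not_summable_inverse_const_n_ln) simp
    show "0 \<le> (\<integral>\<omega>. ((Y \<omega>)\<^sup>2) ^ Suc n \<partial>M)" for n
      using moments_nonneg[of "2 * Suc n"] by (simp only: power_mult[symmetric])
  qed
  have "finite_moments M (\<lambda>\<omega>. (Y \<omega>)\<^sup>2)"
    unfolding finite_moments_def power_mult[symmetric] using int by blast
  then have "moment_determinate_stieltjes M (\<lambda>\<omega>. (Y \<omega>)\<^sup>2)"
    using carleman_sq assms(1) by (intro carleman_imp_moment_determinate) auto
  moreover have "moment_determinate_stieltjes M Y"
    using carleman assms(1,4-6) by (intro carleman_imp_moment_determinate)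
  ultimately show ?thesis using carleman carleman_sq by blast
qed

end
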